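(* There is an absolute constant $\kappa>0$ such that the following holds. Let $A\in\mathbb{R}^{m\times n}$ ($m\le n$) have full row rank $m$, let $b\in\mathbb{R}^m$, $c\in\mathbb{R}^n$, assume (PD) has a unique and nondegenerate solution $(x^*,y^*,s^* )$, assume $0<\psi_p<\infty$, let $\gamma\in(0,1)$ and let $\rho=\dfrac{\psi_p}{\max(\tau_p,\tau_d)}$. Provided $$\epsilon(A,b,c)\le\kappa\,\sqrt{n\rho}\,\min\left(\sqrt\rho,1\right),$$ there exists a sufficiently small vector $\bar\lambda=\bar\lambda(A,b,c,x^*,s^* )\in\mathbb{R}^n$, $\bar\lambda>0$, such that $$\mu^{\max}_\lambda>\mu^{\max}$$ for all $\lambda$ with $0<\lambda=\alpha\bar\lambda<\bar\lambda$, $\alpha\in(0,1)$, that satisfy $0<\|\lambda\|<\min\left(1,\frac{\psi_p}{16\max(\tau_p,\tau_d)}\right)$, where $$\mu^{\max}_\lambda=\frac{\psi_p\,\epsilon(A,b_\lambda,c_\lambda)}{4n\max(\tau_p,\tau_d)\left(\sqrt n+\epsilon(A,b_\lambda,c_\lambda)\right)},\qquad \mu^{\max}=\frac{\epsilon^2(A,b,c)}{n^2}\gamma.$$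
   Context: Vector inequalities are componentwise; $\|\cdot\|$ is the Euclidean norm. A minimum over an empty index set is $+\infty$. (PD): minimize $c^Tx$ s.t. $Ax=b$, $x\ge 0$; and its dual, maximize $b^Ty$ s.t. $A^Ty+s=c$, $s\ge0$. $\Omega^P$ is the solution set of the primal problem and $$\psi_p=\inf_{x^*\in\Omega^P}\ \min_{i:\,x^*_i\neq0}x^*_i .$$ A solution of (PD) is a triple $(x^*,y^*,s^* )$ with $x^*$ primal optimal and $(y^*,s^* )$ dual optimal; it is nondegenerate if $x^*$ and $(y^*,s^* )$ are basic solutions, $x^*$ has exactly $m$ positive components and $s^*$ has exactly $n-m$ positive components. For $\lambda\ge0$, (PD$_\lambda$): minimize $(c+\lambda)^T(x+\lambda)$ s.t. $Ax=b$, $x\ge-\lambda$; and its dual, maximize $(b+A\lambda)^Ty$ s.t. $A^Ty+s=c$, $s\ge-\lambda$ (for $\lambda=0$ this is (PD)). Its set of strictly feasible points is $\mathcal{F}^0_\lambda=\{(x,y,s): Ax=b,\ A^Ty+s=c,\ x+\lambda>0,\ s+\lambda>0\}$. Let $\Omega^P_\lambda$ and $\Omega^D_\lambda$ be the primal and dual solution sets of (PD$_\lambda$), and let $(\mathcal{A}_\lambda,\mathcal{I}_\lambda)$ be the strictly complementary partition of $\{1,\dots,n\}$: $\mathcal{I}_\lambda=\{i: x_i+\lambda_i>0 \text{ for some } x\in\Omega^P_\lambda\}$, $\mathcal{A}_\lambda=\{i: s_i+\lambda_i>0\text{ for some }(y,s)\in\Omega^D_\lambda\}$. With $b_\lambda=b+A\lambda$,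 $c_\lambda=c+\lambda$, define $$\epsilon(A,b_\lambda,c_\lambda)=\min\Big(\min_{i\in\mathcal{I}_\lambda}\sup_{x\in\Omega^P_\lambda}(x_i+\lambda_i),\ \min_{i\in\mathcal{A}_\lambda}\sup_{(y,s)\in\Omega^D_\lambda}(s_i+\lambda_i)\Big)>0,\qquad C_2=\frac{n\sqrt n}{\epsilon(A,b_\lambda,c_\lambda)}+n ,$$ and $\epsilon(A,b,c)$ is this quantity for $\lambda=0$. $\tau_p,\tau_d>0$ are fixed constants depending only on $(A,b,c)$ with the property (such constants exist) that for every $\lambda\ge0$ and every $(x,y,s)\in\mathcal{F}^0_\lambda$ there is a solution $(x^*,y^*,s^* )$ of (PD) with $$\|x-x^*\|<\tau_p\big(C_2\mu_\lambda+4\|\lambda\|\max(\|\lambda\|,1)\big),\qquad \|s-s^*\|<\tau_d\big(C_2\mu_\lambda+4\|\lambda\|\max(\|\lambda\|,1)\big),$$ where $\mu_\lambda=(x+\lambda)^T(s+\lambda)/n$. $\gamma\in(0,1)$ is the parameter of the neighbourhood $\{(x,y,s)\in\mathcal{F}^0_0: x_is_i\ge\gamma\, x^Ts/n,\ i=1,\dots,n\}$ of the central path of (PD). *)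

theory Defs
  imports
    Complex_Main
    "HOL-Library.Extended_Real"
    "Jordan_Normal_Form.DL_Rank"
    "Jordan_Normal_Form.DL_Submatrix"
begin

(* On vectors the library's \<le> is the componentwise order (with equal dimensions), but its <
   is the strict part of that order and not the componentwise strict inequality. *)
definition vec_lt :: "real vec \<Rightarrow> real vec \<Rightarrow> bool" where
  "vec_lt u v \<longleftrightarrow> dim_vec u = dim_vec v \<and> (\<forall>i < dim_vec v. u $ i < v $ i)"

definition enorm :: "real vec \<Rightarrow> real" where
  "enorm v = sqrt (v \<bullet> v)"

(* The perturbed pair of linear programs
     minimize   (c + lam)^T (x + lam)   subject to  A x = b,        x \<ge> -lam,
     maximize   (b + A lam)^T y       subject to  A^T y + s = c,  s \<ge> -lam.
   For lam = 0 it is the standard pair, which is always referred to as the case lam = 0 below. *)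

definition primal_feasible :: "real mat \<Rightarrow> real vec \<Rightarrow> real vec \<Rightarrow> real vec set" where
  "primal_feasible A b lam = {x \<in> carrier_vec (dim_col A). A *\<^sub>v x = b \<and> - lam \<le> x}"

definition primal_solutions :: "real mat \<Rightarrow> real vec \<Rightarrow> real vec \<Rightarrow> real vec \<Rightarrow> real vec set" where
  "primal_solutions A b c lam =
     {x \<in> primal_feasible A b lam.
        \<forall>x' \<in> primal_feasible A b lam. (c + lam) \<bullet> (x + lam) \<le> (c + lam) \<bullet> (x' + lam)}"

definition dual_feasible :: "real mat \<Rightarrow> real vec \<Rightarrow> real vec \<Rightarrow> (real vec \<times> real vec) set" where
  "dual_feasible A c lam =
     {(y, s). y \<in> carrier_vec (dim_row A) \<and> s \<in> carrier_vec (dim_col A) \<and>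
        transpose_mat A *\<^sub>v y + s = c \<and> - lam \<le> s}"

definition dual_solutions ::
    "real mat \<Rightarrow> real vec \<Rightarrow> real vec \<Rightarrow> real vec \<Rightarrow> (real vec \<times> real vec) set" where
  "dual_solutions A b c lam =
     {(y, s) \<in> dual_feasible A c lam.
        \<forall>(y', s') \<in> dual_feasible A c lam. (b + A *\<^sub>v lam) \<bullet> y' \<le> (b + A *\<^sub>v lam) \<bullet> y}"

definition pd_solutions ::
    "real mat \<Rightarrow> real vec \<Rightarrow> real vec \<Rightarrow> (real vec \<times> real vec \<times> real vec) set" where
  "pd_solutions A b c =
     {(x, y, s). x \<in> primal_solutions A b c (0\<^sub>v (dim_col A)) \<and>
                 (y, s) \<in> dual_solutions A b c (0\<^sub>v (dim_col A))}"

definition strictly_feasible ::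
    "real mat \<Rightarrow> real vec \<Rightarrow> real vec \<Rightarrow> real vec \<Rightarrow> (real vec \<times> real vec \<times> real vec) set" where
  "strictly_feasible A b c lam =
     {(x, y, s). x \<in> carrier_vec (dim_col A) \<and> y \<in> carrier_vec (dim_row A) \<and>
        s \<in> carrier_vec (dim_col A) \<and>
        A *\<^sub>v x = b \<and> transpose_mat A *\<^sub>v y + s = c \<and>
        vec_lt (0\<^sub>v (dim_col A)) (x + lam) \<and> vec_lt (0\<^sub>v (dim_col A)) (s + lam)}"

definition is_basis :: "real mat \<Rightarrow> nat set \<Rightarrow> bool" where
  "is_basis A B \<longleftrightarrow>
     B \<subseteq> {..<dim_col A} \<and> card B = dim_row A \<and> invertible_mat (submatrix A UNIV B)"

definition primal_basic_solution :: "real mat \<Rightarrow> real vec \<Rightarrow> real vec \<Rightarrow> bool" where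
  "primal_basic_solution A b x \<longleftrightarrow>
     x \<in> carrier_vec (dim_col A) \<and> A *\<^sub>v x = b \<and>
     (\<exists>B. is_basis A B \<and> (\<forall>i < dim_col A. i \<notin> B \<longrightarrow> x $ i = 0))"

definition dual_basic_solution :: "real mat \<Rightarrow> real vec \<Rightarrow> real vec \<Rightarrow> real vec \<Rightarrow> bool" where
  "dual_basic_solution A c y s \<longleftrightarrow>
     y \<in> carrier_vec (dim_row A) \<and> s \<in> carrier_vec (dim_col A) \<and>
     transpose_mat A *\<^sub>v y + s = c \<and>
     (\<exists>B. is_basis A B \<and> (\<forall>i \<in> B. s $ i = 0))"

definition nondegenerate ::
    "real mat \<Rightarrow> real vec \<Rightarrow> real vec \<Rightarrow> real vec \<Rightarrow> real vec \<Rightarrow> real vec \<Rightarrow> bool" where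
  "nondegenerate A b c x y s \<longleftrightarrow>
     primal_basic_solution A b x \<and> dual_basic_solution A c y s \<and>
     card {i. i < dim_col A \<and> 0 < x $ i} = dim_row A \<and>
     card {i. i < dim_col A \<and> 0 < s $ i} = dim_col A - dim_row A"

(* Extended reals, because a minimum over an empty index set is +\<infinity>. *)
definition psi_p :: "real mat \<Rightarrow> real vec \<Rightarrow> real vec \<Rightarrow> ereal" where
  "psi_p A b c =
     (INF x \<in> primal_solutions A b c (0\<^sub>v (dim_col A)).
        INF i \<in> {i. i < dim_col A \<and> x $ i \<noteq> 0}. ereal (x $ i))"

definition I_set :: "real mat \<Rightarrow> real vec \<Rightarrow> real vec \<Rightarrow> real vec \<Rightarrow> nat set" where
  "I_set A b c lam =
     {i. i < dim_col A \<and> (\<exists>x \<in> primal_solutions A b c lam. 0 < x $ i + lam $ i)}"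

definition A_set :: "real mat \<Rightarrow> real vec \<Rightarrow> real vec \<Rightarrow> real vec \<Rightarrow> nat set" where
  "A_set A b c lam =
     {i. i < dim_col A \<and> (\<exists>(y, s) \<in> dual_solutions A b c lam. 0 < s $ i + lam $ i)}"

(* eps A b c lam is the condition number \<epsilon>(A, b + A lam, c + lam); it is taken as a function of the
   unperturbed data and lam, so that \<epsilon>(A, b, c) is eps A b c 0. *)
definition eps :: "real mat \<Rightarrow> real vec \<Rightarrow> real vec \<Rightarrow> real vec \<Rightarrow> ereal" where
  "eps A b c lam =
     min (INF i \<in> I_set A b c lam. SUP x \<in> primal_solutions A b c lam. ereal (x $ i + lam $ i))
         (INF i \<in> A_set A b c lam. SUP (y, s) \<in> dual_solutions A b c lam. ereal (s $ i + lam $ i))"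

definition C2 :: "real mat \<Rightarrow> real vec \<Rightarrow> real vec \<Rightarrow> real vec \<Rightarrow> ereal" where
  "C2 A b c lam =
     (let n = real (dim_col A) in ereal (n * sqrt n) / eps A b c lam + ereal n)"

definition mu :: "nat \<Rightarrow> real vec \<Rightarrow> real vec \<Rightarrow> real vec \<Rightarrow> real" where
  "mu n lam x s = ((x + lam) \<bullet> (s + lam)) / real n"

definition error_bound_constants ::
    "real mat \<Rightarrow> real vec \<Rightarrow> real vec \<Rightarrow> real \<Rightarrow> real \<Rightarrow> bool" where
  "error_bound_constants A b c \<tau>p \<tau>d \<longleftrightarrow>
     0 < \<tau>p \<and> 0 < \<tau>d \<and>
     (\<forall>lam \<in> carrier_vec (dim_col A). 0\<^sub>v (dim_col A) \<le> lam \<longrightarrow>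
        (\<forall>(x, y, s) \<in> strictly_feasible A b c lam.
           \<exists>(x', y', s') \<in> pd_solutions A b c.
             let bound = C2 A b c lam * ereal (mu (dim_col A) lam x s)
                         + ereal (4 * enorm lam * max (enorm lam) 1)
             in ereal (enorm (x - x')) < ereal \<tau>p * bound \<and>
                ereal (enorm (s - s')) < ereal \<tau>d * bound))"

(* In the next two definitions real_of_ereal is only meant for finite values. The value \<infinity>, which
   it maps to 0, would make mu_max_pert equal to 0. *)
definition mu_max_pert ::
    "real mat \<Rightarrow> real vec \<Rightarrow> real vec \<Rightarrow> real \<Rightarrow> real \<Rightarrow> real vec \<Rightarrow> real" where
  "mu_max_pert A b c \<tau>p \<tau>d lam =
     (let n = real (dim_col A); \<psi> = real_of_ereal (psi_p A b c);
          \<epsilon> = real_of_ereal (eps A b c lam)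
      in \<psi> * \<epsilon> / (4 * n * max \<tau>p \<tau>d * (sqrt n + \<epsilon>)))"

definition mu_max :: "real mat \<Rightarrow> real vec \<Rightarrow> real vec \<Rightarrow> real \<Rightarrow> real" where
  "mu_max A b c \<gamma> =
     (let n = real (dim_col A); \<epsilon> = real_of_ereal (eps A b c (0\<^sub>v (dim_col A)))
      in \<epsilon>\<^sup>2 / n\<^sup>2 * \<gamma>)"

end

theory Submission
  imports Defs
begin

text \<open>
  The threshold \<open>mu_max\<close> is quadratic in the condition number \<open>\<epsilon> = \<epsilon>(A,b,c)\<close>, whereas its
  perturbed counterpart is essentially linear in the condition number of the perturbed pair. So the
  perturbed threshold wins as soon as \<open>\<epsilon>\<close> is small and the perturbation does not make the
  condition number much smaller.

  The perturbations are all taken along the direction \<open>(1,...,1)\<close>, and the claim about the condition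
  number is that a short step \<open>a\<close> in this direction keeps at least half of it
  (\<open>eps_perturbation_ge_half\<close>). The unique nondegenerate solution has an invertible basis \<open>B\<close>, and it
  is strictly complementary with respect to \<open>B\<close>: nonnegativity of the reduced costs produces a dual
  optimal slack that vanishes on \<open>B\<close>, by uniqueness this is the given one, and counting its positive
  components shows that it is positive off \<open>B\<close>
  (\<open>unique_nondegenerate_imp_strictly_complementary\<close>). Invertibility of the basis
  columns then gives primal and dual directions along which the solution can be moved linearly in
  \<open>a\<close> so that it satisfies the perturbed constraints and complementarity with the same \<open>B\<close>; its
  finitely many positive slacks at most halve if \<open>a\<close> is small
  (\<open>strictly_complementary_perturbation\<close>). A strictly complementary pair on an invertible basis is the
  only solution, so the condition number is the minimum of its positive slacks
  (\<open>strictly_complementary_unique_solutions\<close>, \<open>eps_strictly_complementary\<close>).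

  What remains is an inequality between real numbers (\<open>perturbed_threshold_exceeds\<close>), for which
  \<open>\<kappa> = 1/10\<close> is small enough.
\<close>

section \<open>Columns of a basis\<close>

lemma basis_index_bij:
  assumes "finite B"
  shows "bij_betw (pick B) {..<card B} B"
proof (rule bij_betwI')
  fix j k assume "j \<in> {..<card B}" "k \<in> {..<card B}"
  then show "pick B j = pick B k \<longleftrightarrow> j = k"
    by (metis card_pick lessThan_iff)
next
  fix j assume "j \<in> {..<card B}"
  then show "pick B j \<in> B" by (simp add: pick_in_set)
next
  fix i assume i: "i \<in> B"
  then have "{a \<in> B. a < i} \<subset> B" by blast
  then have "card {a \<in> B. a < i} < card B" by (simp add: assms psubset_card_mono)
  with i show "\<exists>j\<in>{..<card B}. i = pick B j"
    by (metis lessThan_iff pick_card_in_set)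
qed

text \<open>
  The basis matrix is written entrywise, with \<open>pick B j\<close> the index of the \<open>j\<close>-th basis column, so that
  sums over its columns can be turned into sums over \<open>B\<close>.
\<close>

lemma basis_matrix_inverse:
  fixes A :: "real mat"
  assumes A: "A \<in> carrier_mat m n" and B: "is_basis A B"
  obtains N where "finite B" "B \<subseteq> {..<n}" "card B = m" "N \<in> carrier_mat m m"
    "mat m m (\<lambda>(k, j). A $$ (k, pick B j)) * N = 1\<^sub>m m"
    "N * mat m m (\<lambda>(k, j). A $$ (k, pick B j)) = 1\<^sub>m m"
proof -
  define M where "M = mat m m (\<lambda>(k, j). A $$ (k, pick B j))"
  have Bn: "B \<subseteq> {..<n}" "card B = m" and inv: "invertible_mat (submatrix A UNIV B)"
    using B A unfolding is_basis_def by auto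
  have "{j. j < n \<and> j \<in> B} = B" using Bn by auto
  then have "submatrix A UNIV B = M"
    unfolding submatrix_def M_def using A Bn by (simp add: pick_UNIV)
  with inv obtain N where MN: "M * N = 1\<^sub>m m" and NM: "N * M = 1\<^sub>m (dim_row N)"
    unfolding invertible_mat_def inverts_mat_def M_def by auto
  from MN have "dim_col (M * N) = m" by simp
  moreover from NM have "dim_col (N * M) = dim_row N" by (metis index_one_mat(3))
  ultimately have "N \<in> carrier_mat m m" unfolding M_def by auto
  with MN NM Bn show thesis unfolding M_def
    by (intro that[of N]) (auto intro: finite_subset)
qed

lemma basis_columns_span:
  fixes A :: "real mat"
  assumes A: "A \<in> carrier_mat m n" and B: "is_basis A B" and r: "r \<in> carrier_vec m"
  obtains d where "d \<in> carrier_vec n" "\<And>i. i < n \<Longrightarrow> i \<notin> B \<Longrightarrow> d $ i = 0" "A *\<^sub>v d = r"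
proof -
  define M where "M = mat m m (\<lambda>(k, j). A $$ (k, pick B j))"
  obtain N where Bn: "finite B" "B \<subseteq> {..<n}" "card B = m" and N: "N \<in> carrier_mat m m"
    and MN: "M * N = 1\<^sub>m m"
    using basis_matrix_inverse[OF A B] unfolding M_def by blast
  have M: "M \<in> carrier_mat m m" unfolding M_def by simp
  define z where "z = N *\<^sub>v r"
  have z: "z \<in> carrier_vec m" unfolding z_def using N r by simp
  have Mz: "M *\<^sub>v z = r"
    unfolding z_def using assoc_mult_mat_vec[OF M N r] MN r by simp
  \<comment> \<open>\<open>i \<mapsto> card {a \<in> B. a < i}\<close> is the inverse of \<open>pick B\<close> on \<open>B\<close>.\<close>
  define d where "d = vec n (\<lambda>i. if i \<in> B then z $ card {a \<in> B. a < i} else 0)"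
  have "(A *\<^sub>v d) $ k = r $ k" if k: "k < m" for k
  proof -
    have "(A *\<^sub>v d) $ k = (\<Sum>i\<in>{0..<n}. A $$ (k, i) * d $ i)"
      using A k by (simp add: scalar_prod_def d_def)
    also have "\<dots> = (\<Sum>i\<in>B. A $$ (k, i) * d $ i)"
      using Bn by (intro sum.mono_neutral_right) (auto simp: d_def)
    also have "\<dots> = (\<Sum>j\<in>{..<m}. A $$ (k, pick B j) * d $ pick B j)"
      using sum.reindex_bij_betw[OF basis_index_bij[OF Bn(1)], symmetric] Bn by simp
    also have "\<dots> = (\<Sum>j\<in>{0..<m}. M $$ (k, j) * z $ j)"
    proof (rule sum.cong)
      fix j assume "j \<in> {0..<m}"
      then have j: "j < card B" using Bn by simp
      then have "pick B j \<in> B" "card {a \<in> B. a < pick B j} = j"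
        by (simp_all add: pick_in_set card_pick)
      then have "d $ pick B j = z $ j" using Bn unfolding d_def by auto
      then show "A $$ (k, pick B j) * d $ pick B j = M $$ (k, j) * z $ j"
        using j k Bn unfolding M_def by simp
    qed auto
    also have "\<dots> = (M *\<^sub>v z) $ k"
      using M z k by (simp add: scalar_prod_def)
    finally show ?thesis using Mz by simp
  qed
  then have "A *\<^sub>v d = r" using A r by (intro eq_vecI) auto
  then show thesis by (intro that[of d]) (auto simp: d_def)
qed

text \<open>
  The dual counterpart of \<open>basis_columns_span\<close>: since the transposed basis matrix is invertible as
  well, the components of \<open>A\<^sup>T v\<close> on \<open>B\<close> can be prescribed.
\<close>

lemma basis_columns_interpolate:
  fixes A :: "real mat"
  assumes A: "A \<in> carrier_mat m n" and B: "is_basis A B"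
  obtains v where "v \<in> carrier_vec m" "\<And>i. i \<in> B \<Longrightarrow> (transpose_mat A *\<^sub>v v) $ i = g i"
proof -
  define M where "M = mat m m (\<lambda>(k, j). A $$ (k, pick B j))"
  obtain N where Bn: "finite B" "B \<subseteq> {..<n}" "card B = m" and N: "N \<in> carrier_mat m m"
    and NM: "N * M = 1\<^sub>m m"
    using basis_matrix_inverse[OF A B] unfolding M_def by blast
  have M: "M \<in> carrier_mat m m" unfolding M_def by simp
  define r where "r = vec m (\<lambda>j. g (pick B j))"
  have r: "r \<in> carrier_vec m" unfolding r_def by simp
  define v where "v = transpose_mat N *\<^sub>v r"
  have v: "v \<in> carrier_vec m" unfolding v_def using N r by simp
  have "transpose_mat M * transpose_mat N = 1\<^sub>m m"
    using transpose_mult[OF N M] NM by simp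
  then have MTv: "transpose_mat M *\<^sub>v v = r"
    unfolding v_def using assoc_mult_mat_vec[of "transpose_mat M" m m "transpose_mat N" m r] M N r
    by simp
  have "(transpose_mat A *\<^sub>v v) $ i = g i" if i: "i \<in> B" for i
  proof -
    obtain j where j: "j < m" "i = pick B j"
      using basis_index_bij[OF Bn(1)] i Bn unfolding bij_betw_def by auto
    have "row (transpose_mat A) i = row (transpose_mat M) j"
      using A Bn i j unfolding M_def by (intro eq_vecI) auto
    then have "(transpose_mat A *\<^sub>v v) $ i = (transpose_mat M *\<^sub>v v) $ j"
      using A M Bn i j by auto
    then show ?thesis using MTv j by (simp add: r_def)
  qed
  then show thesis using that v by blast
qed

lemma scalar_prod_self_eq_0:
  fixes v :: "real vec"
  assumes v: "v \<in> carrier_vec n" and "v \<bullet> v = 0"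
  shows "v = 0\<^sub>v n"
proof -
  have "(\<Sum>i\<in>{0..<n}. v $ i * v $ i) = 0" using assms by (simp add: scalar_prod_def)
  then have "\<forall>i\<in>{0..<n}. v $ i * v $ i = 0" by (subst (asm) sum_nonneg_eq_0_iff) auto
  then show ?thesis using v by (intro eq_vecI) auto
qed

lemma scalar_prod_eq_0_disjoint:
  fixes u v :: "real vec"
  assumes "v \<in> carrier_vec n" "\<And>i. i < n \<Longrightarrow> u $ i = 0 \<or> v $ i = 0"
  shows "u \<bullet> v = 0"
  using assms unfolding scalar_prod_def by (auto intro!: sum.neutral)

text \<open>
  Solvability of each system yields uniqueness for the transposed one through
  \<open>(A\<^sup>T v) \<bullet> d = v \<bullet> (A d)\<close>: here \<open>v\<close> is chosen such that \<open>A\<^sup>T v\<close> agrees with \<open>d\<close> on \<open>B\<close>, which turns the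
  left-hand side into \<open>d \<bullet> d\<close>.
\<close>

lemma basis_columns_independent:
  assumes A: "A \<in> carrier_mat m n" and B: "is_basis A B" and d: "d \<in> carrier_vec n"
    and off: "\<And>i. i < n \<Longrightarrow> i \<notin> B \<Longrightarrow> d $ i = 0" and Ad: "A *\<^sub>v d = 0\<^sub>v m"
  shows "d = 0\<^sub>v n"
proof -
  obtain v where v: "v \<in> carrier_vec m"
    and vd: "\<And>i. i \<in> B \<Longrightarrow> (transpose_mat A *\<^sub>v v) $ i = d $ i"
    using basis_columns_interpolate[OF A B, of "\<lambda>i. d $ i"] by blast
  have "d \<bullet> d = (transpose_mat A *\<^sub>v v) \<bullet> d"
    unfolding scalar_prod_def
  proof (rule sum.cong)
    fix i assume "i \<in> {0..<dim_vec d}"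
    then show "d $ i * d $ i = (transpose_mat A *\<^sub>v v) $ i * d $ i"
      using d off[of i] vd[of i] by (cases "i \<in> B") auto
  qed simp
  also have "\<dots> = 0" using transpose_vec_mult_scalar[OF A d v] Ad v by simp
  finally show ?thesis using scalar_prod_self_eq_0[OF d] by simp
qed

lemma basis_columns_determine_multiplier:
  assumes A: "A \<in> carrier_mat m n" and B: "is_basis A B" and v: "v \<in> carrier_vec m"
    and on: "\<And>i. i \<in> B \<Longrightarrow> (transpose_mat A *\<^sub>v v) $ i = 0"
  shows "v = 0\<^sub>v m"
proof -
  obtain d where d: "d \<in> carrier_vec n" and off: "\<And>i. i < n \<Longrightarrow> i \<notin> B \<Longrightarrow> d $ i = 0"
    and Ad: "A *\<^sub>v d = v"
    using basis_columns_span[OF A B v] by blast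
  have "v \<bullet> v = (transpose_mat A *\<^sub>v v) \<bullet> d"
    using transpose_vec_mult_scalar[OF A d v] Ad by simp
  also have "\<dots> = 0" using d off on by (intro scalar_prod_eq_0_disjoint) auto
  finally show ?thesis using scalar_prod_self_eq_0[OF v] by simp
qed

lemma mult_mat_vec_add_kernel:
  fixes A :: "real mat"
  assumes A: "A \<in> carrier_mat m n" and x: "x \<in> carrier_vec n" and d: "d \<in> carrier_vec n"
    and Ad: "A *\<^sub>v d = 0\<^sub>v m"
  shows "A *\<^sub>v (x + t \<cdot>\<^sub>v d) = A *\<^sub>v x"
proof -
  have "A *\<^sub>v (x + t \<cdot>\<^sub>v d) = A *\<^sub>v x + t \<cdot>\<^sub>v (A *\<^sub>v d)"
    using mult_add_distrib_mat_vec[OF A x] mult_mat_vec[OF A d] d by simp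
  also have "t \<cdot>\<^sub>v (A *\<^sub>v d) = 0\<^sub>v m" unfolding Ad by (intro eq_vecI) auto
  finally show ?thesis using A x by simp
qed

section \<open>Step lengths\<close>

text \<open>
  Finitely many positive quantities \<open>f i\<close> that change at the rates \<open>g i\<close> all keep at least half of
  their size for a common positive time.
\<close>

lemma small_step:
  fixes f g :: "'a \<Rightarrow> real"
  assumes "finite S" "\<And>i. i \<in> S \<Longrightarrow> 0 < f i"
  obtains t where "0 < t" "\<And>i. i \<in> S \<Longrightarrow> t * \<bar>g i\<bar> \<le> f i / 2"
proof -
  have "\<exists>t>0. \<forall>i\<in>S. t * \<bar>g i\<bar> \<le> f i / 2" using assms
  proof (induction S)
    case empty
    show ?case by (intro exI[of _ 1]) simp
  next
    case (insert j S)
    then obtain t where t: "0 < t" "\<forall>i\<in>S. t * \<bar>g i\<bar> \<le> f i / 2" by auto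
    define u where "u = f j / (2 * (\<bar>g j\<bar> + 1))"
    have fj: "0 < f j" using insert by simp
    have u: "0 < u" unfolding u_def using fj by simp
    have "u * \<bar>g j\<bar> \<le> u * (\<bar>g j\<bar> + 1)" using u by simp
    also have "\<dots> = f j / 2" unfolding u_def by (simp add: field_simps)
    finally have ug: "u * \<bar>g j\<bar> \<le> f j / 2" .
    show ?case
    proof (intro exI[of _ "min t u"] conjI ballI)
      show "0 < min t u" using t u by simp
      fix i assume "i \<in> insert j S"
      then have "t * \<bar>g i\<bar> \<le> f i / 2 \<or> u * \<bar>g i\<bar> \<le> f i / 2" using t ug by auto
      then show "min t u * \<bar>g i\<bar> \<le> f i / 2"
        by (meson abs_ge_zero min.cobounded1 min.cobounded2 mult_right_mono order_trans)
    qed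
  qed
  then show thesis using that by blast
qed

lemma half_le_add_small:
  fixes f g :: real
  assumes "t * \<bar>g\<bar> \<le> f / 2" "0 \<le> a" "a \<le> t"
  shows "f / 2 \<le> f + a * g"
proof -
  have "- (a * g) \<le> a * \<bar>g\<bar>" using assms(2) by (metis abs_ge_minus_self abs_mult abs_of_nonneg)
  also have "\<dots> \<le> t * \<bar>g\<bar>" using assms(3) by (simp add: mult_right_mono)
  finally show ?thesis using assms(1) by simp
qed

section \<open>Duality and complementary slackness\<close>

lemma scalar_prod_nonneg:
  fixes u v :: "real vec"
  assumes "v \<in> carrier_vec n" "\<And>i. i < n \<Longrightarrow> 0 \<le> u $ i" "\<And>i. i < n \<Longrightarrow> 0 \<le> v $ i"
  shows "0 \<le> u \<bullet> v"
  using assms unfolding scalar_prod_def by (auto intro!: sum_nonneg)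

lemma scalar_prod_nonneg_eq_0:
  fixes u v :: "real vec"
  assumes v: "v \<in> carrier_vec n" and nn: "\<And>i. i < n \<Longrightarrow> 0 \<le> u $ i" "\<And>i. i < n \<Longrightarrow> 0 \<le> v $ i"
    and "u \<bullet> v \<le> 0" and i: "i < n"
  shows "u $ i * v $ i = 0"
proof -
  have "u \<bullet> v = 0" using assms scalar_prod_nonneg[OF v nn] by simp
  then have "(\<Sum>i\<in>{0..<n}. u $ i * v $ i) = 0" using v by (simp add: scalar_prod_def)
  then have "\<forall>i\<in>{0..<n}. u $ i * v $ i = 0" using nn by (subst (asm) sum_nonneg_eq_0_iff) auto
  then show ?thesis using i by simp
qed

lemma uminus_vec_le_iff:
  fixes x lam :: "real vec"
  assumes "x \<in> carrier_vec n" "lam \<in> carrier_vec n"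
  shows "- lam \<le> x \<longleftrightarrow> (\<forall>i<n. 0 \<le> x $ i + lam $ i)"
proof -
  have "(- lam) $ i \<le> x $ i \<longleftrightarrow> 0 \<le> x $ i + lam $ i" if "i < n" for i
    using assms that by auto
  then show ?thesis using assms unfolding less_eq_vec_def by auto
qed

text \<open>
  The gap between the primal and the dual objective is the inner product of the shifted slacks. Weak
  duality, optimality of complementary pairs and uniqueness of strictly complementary ones all follow
  from this identity.
\<close>

lemma duality_gap:
  fixes A :: "real mat"
  assumes A: "A \<in> carrier_mat m n" and lam: "lam \<in> carrier_vec n"
    and x: "x \<in> carrier_vec n" "A *\<^sub>v x = b"
    and y: "y \<in> carrier_vec m" and s: "s \<in> carrier_vec n" "transpose_mat A *\<^sub>v y + s = c"
  shows "(c + lam) \<bullet> (x + lam) = (b + A *\<^sub>v lam) \<bullet> y + (s + lam) \<bullet> (x + lam)"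
proof -
  have Ty: "transpose_mat A *\<^sub>v y \<in> carrier_vec n" using A y by simp
  have xl: "x + lam \<in> carrier_vec n" using x lam by simp
  have Axl: "A *\<^sub>v (x + lam) = b + A *\<^sub>v lam"
    using mult_add_distrib_mat_vec[OF A x(1) lam] x by simp
  have "c + lam = transpose_mat A *\<^sub>v y + (s + lam)"
    using Ty s lam assoc_add_vec[OF Ty s(1) lam] by simp
  then have "(c + lam) \<bullet> (x + lam) = (transpose_mat A *\<^sub>v y) \<bullet> (x + lam) + (s + lam) \<bullet> (x + lam)"
    using add_scalar_prod_distrib[OF Ty _ xl, of "s + lam"] s lam by simp
  also have "(transpose_mat A *\<^sub>v y) \<bullet> (x + lam) = y \<bullet> (b + A *\<^sub>v lam)"
    using transpose_vec_mult_scalar[OF A xl y] Axl by simp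
  also have "\<dots> = (b + A *\<^sub>v lam) \<bullet> y"
    using A x lam y by (intro comm_scalar_prod[of _ m]) auto
  finally show ?thesis by simp
qed

lemma dual_constraint_index:
  fixes A :: "real mat"
  assumes "A \<in> carrier_mat m n" "s \<in> carrier_vec n" "transpose_mat A *\<^sub>v y + s = c" "i < n"
  shows "(transpose_mat A *\<^sub>v y) $ i = c $ i - s $ i"
proof -
  have "c $ i = (transpose_mat A *\<^sub>v y) $ i + s $ i"
    using assms(1,2,4) by (subst assms(3)[symmetric]) simp
  then show ?thesis by simp
qed

lemma complementary_imp_optimal:
  fixes A :: "real mat"
  assumes A: "A \<in> carrier_mat m n" and lam: "lam \<in> carrier_vec n"
    and x: "x \<in> primal_feasible A b lam" and ys: "(y, s) \<in> dual_feasible A c lam"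
    and compl: "\<And>i. i < n \<Longrightarrow> s $ i + lam $ i = 0 \<or> x $ i + lam $ i = 0"
  shows "x \<in> primal_solutions A b c lam" "(y, s) \<in> dual_solutions A b c lam"
proof -
  have gap: "(c + lam) \<bullet> (x' + lam) = (b + A *\<^sub>v lam) \<bullet> y' + (s' + lam) \<bullet> (x' + lam)"
    if "x' \<in> primal_feasible A b lam" "(y', s') \<in> dual_feasible A c lam" for x' y' s'
    using that A unfolding primal_feasible_def dual_feasible_def
    by (intro duality_gap[OF A lam]) auto
  have nonneg: "0 \<le> (s' + lam) \<bullet> (x' + lam)"
    if "x' \<in> primal_feasible A b lam" "(y', s') \<in> dual_feasible A c lam" for x' y' s'
    using that A lam unfolding primal_feasible_def dual_feasible_def
    by (intro scalar_prod_nonneg[of _ n]) (auto simp: uminus_vec_le_iff[of _ n])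
  have zero: "(s + lam) \<bullet> (x + lam) = 0"
    using x ys A lam compl unfolding primal_feasible_def dual_feasible_def
    by (intro scalar_prod_eq_0_disjoint[of _ n]) auto
  show "x \<in> primal_solutions A b c lam"
  proof -
    have "(c + lam) \<bullet> (x + lam) \<le> (c + lam) \<bullet> (x' + lam)"
      if "x' \<in> primal_feasible A b lam" for x'
      using gap[OF x ys] zero gap[OF that ys] nonneg[OF that ys] by linarith
    then show ?thesis using x unfolding primal_solutions_def by auto
  qed
  show "(y, s) \<in> dual_solutions A b c lam"
  proof -
    have "(b + A *\<^sub>v lam) \<bullet> y' \<le> (b + A *\<^sub>v lam) \<bullet> y"
      if "(y', s') \<in> dual_feasible A c lam" for y' s'
      using gap[OF x ys] zero gap[OF x that] nonneg[OF x that] by linarith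
    then show ?thesis using ys unfolding dual_solutions_def by auto
  qed
qed

text \<open>
  The reduced costs of a nondegenerate optimal basis are nonnegative: as the basic variables are
  strictly positive, the simplex step on a variable with negative reduced cost would have positive
  length and lower the objective.
\<close>

lemma optimal_basic_imp_dual_feasible:
  fixes A :: "real mat"
  assumes A: "A \<in> carrier_mat m n" and b: "b \<in> carrier_vec m" and c: "c \<in> carrier_vec n"
    and lam: "lam \<in> carrier_vec n" and B: "is_basis A B"
    and opt: "x \<in> primal_solutions A b c lam"
    and on: "\<And>i. i \<in> B \<Longrightarrow> 0 < x $ i + lam $ i"
    and off: "\<And>i. i < n \<Longrightarrow> i \<notin> B \<Longrightarrow> x $ i + lam $ i = 0"
  obtains y s where "(y, s) \<in> dual_feasible A c lam" "\<And>i. i \<in> B \<Longrightarrow> s $ i + lam $ i = 0"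
proof -
  have Bn: "B \<subseteq> {..<n}" and finB: "finite B"
    using B A unfolding is_basis_def by (auto intro: finite_subset)
  have xc: "x \<in> carrier_vec n" "A *\<^sub>v x = b"
    using opt A unfolding primal_solutions_def primal_feasible_def by auto
  obtain y where y: "y \<in> carrier_vec m"
    and yB: "\<And>i. i \<in> B \<Longrightarrow> (transpose_mat A *\<^sub>v y) $ i = c $ i + lam $ i"
    using basis_columns_interpolate[OF A B, of "\<lambda>i. c $ i + lam $ i"] by blast
  define s where "s = c - transpose_mat A *\<^sub>v y"
  have Ty: "transpose_mat A *\<^sub>v y \<in> carrier_vec n" using A y by simp
  have s: "s \<in> carrier_vec n" "transpose_mat A *\<^sub>v y + s = c"
  proof -
    show "s \<in> carrier_vec n" using Ty c unfolding s_def by simp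
    show "transpose_mat A *\<^sub>v y + s = c"
    proof (rule eq_vecI)
      fix i assume "i < dim_vec c"
      then show "(transpose_mat A *\<^sub>v y + s) $ i = c $ i"
        using A y c unfolding s_def by (simp del: index_mult_mat_vec)
    qed (use A y c in \<open>simp add: s_def\<close>)
  qed
  have sB: "s $ i + lam $ i = 0" if "i \<in> B" for i
  proof -
    have "i < n" using that Bn by auto
    then show ?thesis
      using dual_constraint_index[OF A s] yB[OF that] by (simp del: index_mult_mat_vec)
  qed
  have "0 \<le> s $ j + lam $ j" if j: "j < n" for j
  proof (rule ccontr)
    assume neg: "\<not> 0 \<le> s $ j + lam $ j"
    then have jB: "j \<notin> B" using sB by force
    \<comment> \<open>The simplex step: raise \<open>x\<^sub>j\<close> and compensate within the basis columns.\<close>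
    obtain d' where d': "d' \<in> carrier_vec n" "\<And>i. i < n \<Longrightarrow> i \<notin> B \<Longrightarrow> d' $ i = 0"
      and Ad': "A *\<^sub>v d' = - (A *\<^sub>v unit_vec n j)"
      using basis_columns_span[OF A B, of "- (A *\<^sub>v unit_vec n j)"] A by auto
    obtain t where t: "0 < t" and small: "\<And>i. i \<in> B \<Longrightarrow> t * \<bar>d' $ i\<bar> \<le> (x $ i + lam $ i) / 2"
      using small_step[of B "\<lambda>i. x $ i + lam $ i" "\<lambda>i. d' $ i", OF finB on] by blast
    define x' where "x' = x + t \<cdot>\<^sub>v (d' + unit_vec n j)"
    have x'c: "x' \<in> carrier_vec n" unfolding x'_def using xc d' by simp
    have "A *\<^sub>v (d' + unit_vec n j) = 0\<^sub>v m"
      using mult_add_distrib_mat_vec[OF A d'(1), of "unit_vec n j"] Ad' A by simp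
    then have Ax': "A *\<^sub>v x' = b"
      unfolding x'_def using mult_mat_vec_add_kernel[OF A xc(1)] d' xc by simp
    have x'B: "0 \<le> x' $ i + lam $ i" if "i \<in> B" for i
    proof -
      have "0 \<le> x $ i + lam $ i + t * d' $ i"
        using half_le_add_small[OF small[OF that], of t] on[OF that] t by simp
      moreover have "i < n" "i \<noteq> j" using that Bn jB by auto
      ultimately show ?thesis unfolding x'_def using d' xc j by simp
    qed
    have x'N: "x' $ i + lam $ i = (if i = j then t else 0)" if "i < n" "i \<notin> B" for i
      unfolding x'_def using d' xc j off[OF that] that by auto
    have "x' \<in> primal_feasible A b lam"
    proof -
      have "0 \<le> x' $ i + lam $ i" if "i < n" for i
        using x'B x'N[OF that] t by (cases "i \<in> B") auto
      then show ?thesis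
        using x'c Ax' A lam uminus_vec_le_iff[of x' n lam] unfolding primal_feasible_def by auto
    qed
    then have le: "(c + lam) \<bullet> (x + lam) \<le> (c + lam) \<bullet> (x' + lam)"
      using opt unfolding primal_solutions_def by auto
    have "(s + lam) \<bullet> (x + lam) = 0"
      using sB off xc s lam by (intro scalar_prod_eq_0_disjoint[of _ n]) auto
    then have "0 \<le> (s + lam) \<bullet> (x' + lam)"
      using le duality_gap[OF A lam xc y s] duality_gap[OF A lam x'c Ax' y s] by simp
    \<comment> \<open>The slack products vanish on \<open>B\<close> through \<open>s\<close> and off \<open>B\<close>, except at \<open>j\<close>, through \<open>x'\<close>.\<close>
    also have "\<dots> = (\<Sum>i\<in>{0..<n}. if i = j then (s $ j + lam $ j) * t else 0)"
      unfolding scalar_prod_def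
    proof (rule sum.cong)
      fix i assume "i \<in> {0..<n}"
      then show "(s + lam) $ i * (x' + lam) $ i = (if i = j then (s $ j + lam $ j) * t else 0)"
        using sB x'N[of i] s x'c lam jB by (cases "i \<in> B") auto
    qed (use lam in simp)
    also have "\<dots> = (s $ j + lam $ j) * t" using j by simp
    also have "\<dots> < 0" using neg t by (simp add: mult_neg_pos)
    finally show False by simp
  qed
  then have "(y, s) \<in> dual_feasible A c lam"
    using y s A lam uminus_vec_le_iff[of s n lam] unfolding dual_feasible_def by auto
  then show thesis using that sB by blast
qed

section \<open>Strictly complementary pairs on a basis\<close>

definition strictly_complementary ::
    "real mat \<Rightarrow> real vec \<Rightarrow> real vec \<Rightarrow> real vec \<Rightarrow> nat set \<Rightarrow> real vec \<Rightarrow> real vec \<Rightarrow> real vec \<Rightarrow> bool"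
  where
  "strictly_complementary A b c lam B x y s \<longleftrightarrow>
     x \<in> primal_feasible A b lam \<and> (y, s) \<in> dual_feasible A c lam \<and>
     (\<forall>i \<in> {..<dim_col A}. if i \<in> B then 0 < x $ i + lam $ i \<and> s $ i + lam $ i = 0
                           else x $ i + lam $ i = 0 \<and> 0 < s $ i + lam $ i)"

text \<open>
  By \<open>duality_gap\<close>, another primal solution \<open>x'\<close> also satisfies complementarity with \<open>s\<close>. As
  \<open>s + lam\<close> is positive off \<open>B\<close>, this makes \<open>x'\<close> and \<open>x\<close> agree there, and independence of the basis
  columns leaves only \<open>x' = x\<close>.
  The dual argument is the same, with the slacks determined on \<open>B\<close>.
\<close>

lemma strictly_complementary_unique_solutions:
  fixes A :: "real mat"
  assumes A: "A \<in> carrier_mat m n" and b: "b \<in> carrier_vec m" and lam: "lam \<in> carrier_vec n"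
    and B: "is_basis A B" and sc: "strictly_complementary A b c lam B x y s"
  shows "primal_solutions A b c lam = {x}" "dual_solutions A b c lam = {(y, s)}"
proof -
  have x: "x \<in> primal_feasible A b lam" and ys: "(y, s) \<in> dual_feasible A c lam"
    and on: "\<And>i. i < n \<Longrightarrow> i \<in> B \<Longrightarrow> 0 < x $ i + lam $ i \<and> s $ i + lam $ i = 0"
    and off: "\<And>i. i < n \<Longrightarrow> i \<notin> B \<Longrightarrow> x $ i + lam $ i = 0 \<and> 0 < s $ i + lam $ i"
    using sc A unfolding strictly_complementary_def by (auto split: if_splits)
  have opt: "x \<in> primal_solutions A b c lam" "(y, s) \<in> dual_solutions A b c lam"
    using complementary_imp_optimal[OF A lam x ys] on off by blast+
  have xc: "x \<in> carrier_vec n" "A *\<^sub>v x = b" "\<forall>i<n. 0 \<le> x $ i + lam $ i"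
    using x A lam uminus_vec_le_iff[of x n lam] unfolding primal_feasible_def by auto
  have yc: "y \<in> carrier_vec m" "s \<in> carrier_vec n" "transpose_mat A *\<^sub>v y + s = c"
    "\<forall>i<n. 0 \<le> s $ i + lam $ i"
    using ys A lam uminus_vec_le_iff[of s n lam] unfolding dual_feasible_def by auto
  have zero: "(s + lam) \<bullet> (x + lam) = 0"
    using on off xc yc lam by (intro scalar_prod_eq_0_disjoint[of _ n]) auto
  have gap0: "(c + lam) \<bullet> (x + lam) = (b + A *\<^sub>v lam) \<bullet> y"
    using duality_gap[OF A lam xc(1,2) yc(1,2,3)] zero by simp
  have "x' = x" if x': "x' \<in> primal_solutions A b c lam" for x'
  proof -
    have x'c: "x' \<in> carrier_vec n" "A *\<^sub>v x' = b" "\<forall>i<n. 0 \<le> x' $ i + lam $ i"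
      and le: "(c + lam) \<bullet> (x' + lam) \<le> (c + lam) \<bullet> (x + lam)"
      using x' x A lam uminus_vec_le_iff[of x' n lam]
      unfolding primal_solutions_def primal_feasible_def by auto
    have "(s + lam) \<bullet> (x' + lam) \<le> 0"
      using duality_gap[OF A lam x'c(1,2) yc(1,2,3)] gap0 le by simp
    then have prods: "(s + lam) $ i * (x' + lam) $ i = 0" if "i < n" for i
      using that x'c yc lam by (intro scalar_prod_nonneg_eq_0[of _ n]) auto
    define d where "d = x' - x"
    have d: "d \<in> carrier_vec n" unfolding d_def using x'c xc by simp
    have "d $ i = 0" if "i < n" "i \<notin> B" for i
      using prods[OF that(1)] off[OF that] that x'c xc yc lam unfolding d_def by auto
    moreover have "A *\<^sub>v d = 0\<^sub>v m"
      unfolding d_def using mult_minus_distrib_mat_vec[OF A x'c(1) xc(1)] x'c xc b by simp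
    ultimately have "d = 0\<^sub>v n" using basis_columns_independent[OF A B d] by blast
    then have "d $ i = 0" if "i < n" for i using that by simp
    then have "x' $ i = x $ i" if "i < n" for i
      using that x'c xc unfolding d_def by force
    then show "x' = x" using x'c xc by (intro eq_vecI) auto
  qed
  then show "primal_solutions A b c lam = {x}" using opt by blast
  have "(y', s') = (y, s)" if ys': "(y', s') \<in> dual_solutions A b c lam" for y' s'
  proof -
    have y'c: "y' \<in> carrier_vec m" "s' \<in> carrier_vec n" "transpose_mat A *\<^sub>v y' + s' = c"
        "\<forall>i<n. 0 \<le> s' $ i + lam $ i"
      and le: "(b + A *\<^sub>v lam) \<bullet> y \<le> (b + A *\<^sub>v lam) \<bullet> y'"
      using ys' ys A lam uminus_vec_le_iff[of s' n lam]
      unfolding dual_solutions_def dual_feasible_def by auto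
    have "(s' + lam) \<bullet> (x + lam) \<le> 0"
      using duality_gap[OF A lam xc(1,2) y'c(1,2,3)] gap0 le by simp
    then have prods: "(s' + lam) $ i * (x + lam) $ i = 0" if "i < n" for i
      using that y'c xc lam by (intro scalar_prod_nonneg_eq_0[of _ n]) auto
    have s'B: "s' $ i = s $ i" if "i \<in> B" for i
    proof -
      have "i < n" using that B A unfolding is_basis_def by auto
      then show ?thesis using prods on[OF _ that] y'c xc yc lam by force
    qed
    have Ts: "(transpose_mat A *\<^sub>v y') $ i = c $ i - s' $ i"
      "(transpose_mat A *\<^sub>v y) $ i = c $ i - s $ i" if "i < n" for i
      using dual_constraint_index[OF A y'c(2,3) that] dual_constraint_index[OF A yc(2,3) that]
      by (simp_all only:)
    define v where "v = y' - y"
    have v: "v \<in> carrier_vec m" unfolding v_def using y'c yc by simp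
    have "(transpose_mat A *\<^sub>v v) $ i = 0" if i: "i \<in> B" for i
    proof -
      have "i < n" using i B A unfolding is_basis_def by auto
      moreover have "transpose_mat A *\<^sub>v v = transpose_mat A *\<^sub>v y' - transpose_mat A *\<^sub>v y"
        unfolding v_def using A y'c yc by (intro mult_minus_distrib_mat_vec[of _ n m]) auto
      ultimately show ?thesis using Ts s'B[OF i] A by simp
    qed
    then have "v = 0\<^sub>v m" using basis_columns_determine_multiplier[OF A B v] by blast
    then have "v $ i = 0" if "i < m" for i using that by simp
    then have "y' $ i = y $ i" if "i < m" for i
      using that y'c yc unfolding v_def by force
    then have yy: "y' = y" using y'c yc by (intro eq_vecI) auto
    have "s' $ i = s $ i" if "i < n" for i using Ts[OF that] yy by simp
    then have "s' = s" using y'c(2) yc(2) by (intro eq_vecI) auto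
    then show ?thesis using yy by simp
  qed
  then have "dual_solutions A b c lam \<subseteq> {(y, s)}" by (metis singletonI subrelI)
  then show "dual_solutions A b c lam = {(y, s)}" using opt(2) by blast
qed

lemma eps_strictly_complementary:
  fixes A :: "real mat"
  assumes A: "A \<in> carrier_mat m n" and b: "b \<in> carrier_vec m" and lam: "lam \<in> carrier_vec n"
    and B: "is_basis A B" and sc: "strictly_complementary A b c lam B x y s"
  shows "eps A b c lam =
    min (INF i\<in>B. ereal (x $ i + lam $ i)) (INF i\<in>{..<n} - B. ereal (s $ i + lam $ i))"
proof -
  note sols = strictly_complementary_unique_solutions[OF assms]
  have Bn: "B \<subseteq> {..<n}" using B A unfolding is_basis_def by auto
  have vals: "(i \<in> B \<longrightarrow> 0 < x $ i + lam $ i \<and> s $ i + lam $ i = 0) \<and>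
      (i \<notin> B \<longrightarrow> x $ i + lam $ i = 0 \<and> 0 < s $ i + lam $ i)" if "i < n" for i
    using sc A that unfolding strictly_complementary_def by (auto split: if_splits)
  have "I_set A b c lam = B" "A_set A b c lam = {..<n} - B"
    using A Bn vals unfolding I_set_def A_set_def sols by force+
  then show ?thesis unfolding eps_def sols by simp
qed

text \<open>
  The thresholds are built from the real value of the condition number, which is the true one because
  the condition number is positive and finite. Any basic variable bounds it from above.
\<close>

lemma eps_strictly_complementary_pos_finite:
  fixes A :: "real mat"
  assumes A: "A \<in> carrier_mat m n" and b: "b \<in> carrier_vec m" and lam: "lam \<in> carrier_vec n"
    and B: "is_basis A B" "B \<noteq> {}" and sc: "strictly_complementary A b c lam B x y s"
  shows "0 < eps A b c lam" "eps A b c lam < \<infinity>"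
proof -
  have Bn: "B \<subseteq> {..<n}" and finB: "finite B"
    using B A unfolding is_basis_def by (auto intro: finite_subset)
  have pos: "0 < x $ i + lam $ i" if "i \<in> B" for i
  proof -
    have "i < n" using that Bn by auto
    with sc A that show ?thesis unfolding strictly_complementary_def by (auto split: if_splits)
  qed
  have pos': "0 < s $ i + lam $ i" if "i \<in> {..<n} - B" for i
    using sc A that unfolding strictly_complementary_def by (auto split: if_splits)
  note eps = eps_strictly_complementary[OF A b lam B(1) sc]
  have INF_pos: "0 < (INF i\<in>S. ereal (f i))" if S: "finite S" "\<And>i. i \<in> S \<Longrightarrow> 0 < f i"
    for S :: "nat set" and f :: "nat \<Rightarrow> real"
  proof -
    obtain t where t: "0 < t" "\<And>i. i \<in> S \<Longrightarrow> t * \<bar>1\<bar> \<le> f i / 2"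
      using small_step[of S f "\<lambda>_. 1", OF S] by auto
    have "ereal t \<le> (INF i\<in>S. ereal (f i))"
      using t(2) S(2) by (intro INF_greatest) force
    then show ?thesis using t(1) by (metis ereal_less(2) less_le_trans)
  qed
  have "0 < (INF i\<in>B. ereal (x $ i + lam $ i))" using finB pos by (rule INF_pos)
  moreover have "0 < (INF i\<in>{..<n} - B. ereal (s $ i + lam $ i))"
    using pos' by (intro INF_pos) auto
  ultimately show "0 < eps A b c lam" unfolding eps by simp
  obtain i where i: "i \<in> B" using B(2) by blast
  have "eps A b c lam \<le> ereal (x $ i + lam $ i)"
    unfolding eps using i by (intro min.coboundedI1 INF_lower)
  then show "eps A b c lam < \<infinity>" by (cases "eps A b c lam") auto
qed

text \<open>
  The slack built from the reduced costs is dual optimal, so by uniqueness it is \<open>s\<close>. This gives the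
  complementarity of \<open>x\<close> and \<open>s\<close> without an appeal to strong duality; it is strict because the
  numbers of positive components add up to \<open>n\<close>.
\<close>

lemma unique_nondegenerate_imp_strictly_complementary:
  fixes A :: "real mat"
  assumes A: "A \<in> carrier_mat m n" and b: "b \<in> carrier_vec m" and c: "c \<in> carrier_vec n"
    and uniq: "pd_solutions A b c = {(x, y, s)}" and nd: "nondegenerate A b c x y s"
  obtains B where "is_basis A B" "strictly_complementary A b c (0\<^sub>v n) B x y s"
proof -
  define z where "z = (0\<^sub>v n :: real vec)"
  have z: "z \<in> carrier_vec n" "\<And>i. i < n \<Longrightarrow> z $ i = 0" unfolding z_def by auto
  obtain B where B: "is_basis A B" and off: "\<And>i. i < n \<Longrightarrow> i \<notin> B \<Longrightarrow> x $ i = 0"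
    using nd A unfolding nondegenerate_def primal_basic_solution_def by auto
  have Bn: "B \<subseteq> {..<n}" "card B = m" "finite B"
    using B A unfolding is_basis_def by (auto intro: finite_subset)
  have "{i. i < n \<and> 0 < x $ i} = B"
    using nd A Bn off unfolding nondegenerate_def by (intro card_subset_eq) force+
  then have on: "\<And>i. i \<in> B \<Longrightarrow> 0 < x $ i" by auto
  have "(x, y, s) \<in> pd_solutions A b c" using uniq by simp
  then have opt: "x \<in> primal_solutions A b c z" "(y, s) \<in> dual_solutions A b c z"
    using A unfolding pd_solutions_def z_def by auto
  have xf: "x \<in> primal_feasible A b z" and yf: "(y, s) \<in> dual_feasible A c z"
    using opt unfolding primal_solutions_def dual_solutions_def by auto
  have onz: "0 < x $ i + z $ i" if "i \<in> B" for i using on[OF that] z(2)[of i] that Bn by auto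
  have offz: "x $ i + z $ i = 0" if "i < n" "i \<notin> B" for i using off[OF that] z(2)[of i] that by auto
  obtain y0 s0 where ys0: "(y0, s0) \<in> dual_feasible A c z" "\<And>i. i \<in> B \<Longrightarrow> s0 $ i + z $ i = 0"
    using optimal_basic_imp_dual_feasible[OF A b c z(1) B opt(1) onz offz] by blast
  have "(y0, s0) \<in> dual_solutions A b c z"
    using complementary_imp_optimal(2)[OF A z(1) xf ys0(1)] ys0(2) offz by blast
  then have "(x, y0, s0) \<in> pd_solutions A b c"
    using opt A unfolding pd_solutions_def z_def by auto
  then have "s0 = s" using uniq by auto
  then have sB: "s $ i = 0" if "i \<in> B" for i using ys0(2)[OF that] z(2)[of i] that Bn by auto
  have "{i. i < n \<and> 0 < s $ i} = {..<n} - B"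
  proof (rule card_subset_eq)
    show "{i. i < n \<and> 0 < s $ i} \<subseteq> {..<n} - B" using sB by force
    show "card {i. i < n \<and> 0 < s $ i} = card ({..<n} - B)"
      using nd A Bn unfolding nondegenerate_def by (simp add: card_Diff_subset)
  qed simp
  then have sN: "0 < s $ i" if "i < n" "i \<notin> B" for i using that by blast
  have "strictly_complementary A b c z B x y s"
    using xf yf on off sB sN z A unfolding strictly_complementary_def by auto
  then show thesis using that B unfolding z_def by blast
qed

section \<open>Perturbation along the all-ones direction\<close>

text \<open>
  The solution of the perturbed pair on the same basis is affine in the length \<open>a\<close> of the
  perturbation. Its positive slacks start at the positive components of \<open>x\<close> and \<open>s\<close>, so a single
  \<open>t\<close> keeps all of them at half of their initial values or more.
\<close>

lemma strictly_complementary_perturbation: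
  fixes A :: "real mat"
  assumes A: "A \<in> carrier_mat m n" and b: "b \<in> carrier_vec m" and c: "c \<in> carrier_vec n"
    and B: "is_basis A B" and sc: "strictly_complementary A b c (0\<^sub>v n) B x y s"
  obtains t where "0 < t"
    "\<And>a. 0 \<le> a \<Longrightarrow> a \<le> t \<Longrightarrow> \<exists>x' y' s'. strictly_complementary A b c (vec n (\<lambda>_. a)) B x' y' s' \<and>
       (\<forall>i\<in>B. x $ i / 2 \<le> x' $ i + a) \<and> (\<forall>i\<in>{..<n} - B. s $ i / 2 \<le> s' $ i + a)"
proof -
  have Bn: "B \<subseteq> {..<n}" and finB: "finite B"
    using B A unfolding is_basis_def by (auto intro: finite_subset)
  have x: "x \<in> carrier_vec n" "A *\<^sub>v x = b"
    and y: "y \<in> carrier_vec m" and s: "s \<in> carrier_vec n" "transpose_mat A *\<^sub>v y + s = c"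
    using sc A unfolding strictly_complementary_def primal_feasible_def dual_feasible_def by auto
  have on: "0 < x $ i" "s $ i = 0" if "i \<in> B" for i
  proof -
    have "i < n" using that Bn by auto
    with sc A that show "0 < x $ i" "s $ i = 0"
      unfolding strictly_complementary_def by (auto split: if_splits)
  qed
  have off: "x $ i = 0" "0 < s $ i" if "i < n" "i \<notin> B" for i
    using sc A that unfolding strictly_complementary_def by (auto split: if_splits)
  define e where "e = vec n (\<lambda>_. 1 :: real)"
  have e: "e \<in> carrier_vec n" unfolding e_def by simp
  \<comment> \<open>Moving \<open>x\<close> along \<open>d - e\<close> preserves \<open>A x = b\<close> and changes \<open>x + a e\<close> at the rate \<open>d\<close>, which is
    zero off \<open>B\<close>. Moving \<open>y\<close> along \<open>v\<close> changes \<open>s + a e\<close> at the rate \<open>e - A\<^sup>T v\<close>, which is zero on \<open>B\<close>.\<close>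
  obtain d where d: "d \<in> carrier_vec n" "\<And>i. i < n \<Longrightarrow> i \<notin> B \<Longrightarrow> d $ i = 0" "A *\<^sub>v d = A *\<^sub>v e"
    using basis_columns_span[OF A B, of "A *\<^sub>v e"] A e by auto
  obtain v where v: "v \<in> carrier_vec m" "\<And>i. i \<in> B \<Longrightarrow> (transpose_mat A *\<^sub>v v) $ i = 1"
    using basis_columns_interpolate[OF A B, of "\<lambda>_. 1"] by blast
  define w where "w = transpose_mat A *\<^sub>v v"
  have w: "w \<in> carrier_vec n" unfolding w_def using A v by simp
  obtain t1 where t1: "0 < t1" "\<And>i. i \<in> B \<Longrightarrow> t1 * \<bar>d $ i\<bar> \<le> x $ i / 2"
    using small_step[of B "\<lambda>i. x $ i" "\<lambda>i. d $ i", OF finB on(1)] by blast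
  obtain t2 where t2: "0 < t2" "\<And>i. i \<in> {..<n} - B \<Longrightarrow> t2 * \<bar>1 - w $ i\<bar> \<le> s $ i / 2"
    using small_step[of "{..<n} - B" "\<lambda>i. s $ i" "\<lambda>i. 1 - w $ i"] off(2) by auto
  show thesis
  proof (rule that[of "min t1 t2"])
    show "0 < min t1 t2" using t1 t2 by simp
    fix a :: real assume a: "0 \<le> a" "a \<le> min t1 t2"
    define x' where "x' = x + a \<cdot>\<^sub>v (d - e)"
    define y' where "y' = y + a \<cdot>\<^sub>v v"
    define s' where "s' = s - a \<cdot>\<^sub>v w"
    have x'i: "x' $ i + a = x $ i + a * d $ i" if "i < n" for i
      using that x d e unfolding x'_def by (simp add: e_def algebra_simps)
    have s'i: "s' $ i + a = s $ i + a * (1 - w $ i)" if "i < n" for i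
      using that s w unfolding s'_def by (simp add: algebra_simps)
    have xB: "x $ i / 2 \<le> x' $ i + a" if "i \<in> B" for i
    proof -
      have "i < n" using that Bn by auto
      from half_le_add_small[OF t1(2)[OF that] a(1)] a(2) x'i[OF this] show ?thesis by simp
    qed
    have sB: "s' $ i + a = 0" if "i \<in> B" for i
    proof -
      have "i < n" using that Bn by auto
      from s'i[OF this] on(2)[OF that] v(2)[OF that] show ?thesis unfolding w_def by simp
    qed
    have xN: "x' $ i + a = 0" if "i < n" "i \<notin> B" for i
      using x'i[OF that(1)] off(1)[OF that] d(2)[OF that] by simp
    have sN: "s $ i / 2 \<le> s' $ i + a" if "i < n" "i \<notin> B" for i
      using half_le_add_small[OF t2(2) a(1)] a(2) s'i[OF that(1)] that by simp
    have "A *\<^sub>v (d - e) = 0\<^sub>v m"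
      using mult_minus_distrib_mat_vec[OF A d(1) e] d A e by simp
    then have Ax': "A *\<^sub>v x' = b"
      unfolding x'_def using mult_mat_vec_add_kernel[OF A x(1)] d e x by simp
    have "transpose_mat A *\<^sub>v y' = transpose_mat A *\<^sub>v y + a \<cdot>\<^sub>v w"
      unfolding y'_def w_def using A y v
      by (simp add: mult_add_distrib_mat_vec[of _ n m] mult_mat_vec[of _ n m])
    moreover have "transpose_mat A *\<^sub>v y \<in> carrier_vec n" using A y by simp
    ultimately have Ty': "transpose_mat A *\<^sub>v y' + s' = c"
      unfolding s'_def s(2)[symmetric] using w s(1) by (intro eq_vecI) (auto simp del: index_mult_mat_vec)
    have x': "x' \<in> carrier_vec n" unfolding x'_def using x d e by simp
    have y': "y' \<in> carrier_vec m" unfolding y'_def using y v by simp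
    have s': "s' \<in> carrier_vec n" unfolding s'_def using s w by simp
    have pos: "(i \<in> B \<longrightarrow> 0 < x' $ i + a \<and> s' $ i + a = 0) \<and>
        (i \<notin> B \<longrightarrow> x' $ i + a = 0 \<and> 0 < s' $ i + a)" if "i < n" for i
      using xB[of i] sB[of i] xN[OF that] sN[OF that] on(1)[of i] off(2)[OF that] by force
    then have nn: "\<forall>i<n. 0 \<le> x' $ i + a" "\<forall>i<n. 0 \<le> s' $ i + a" by force+
    have "strictly_complementary A b c (vec n (\<lambda>_. a)) B x' y' s'"
      using A x' y' s' Ax' Ty' nn pos
        uminus_vec_le_iff[of x' n "vec n (\<lambda>_. a)"] uminus_vec_le_iff[of s' n "vec n (\<lambda>_. a)"]
      unfolding strictly_complementary_def primal_feasible_def dual_feasible_def by auto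
    then show "\<exists>x' y' s'. strictly_complementary A b c (vec n (\<lambda>_. a)) B x' y' s' \<and>
       (\<forall>i\<in>B. x $ i / 2 \<le> x' $ i + a) \<and> (\<forall>i\<in>{..<n} - B. s $ i / 2 \<le> s' $ i + a)"
      using xB sN by blast
  qed
qed

lemma eps_perturbation_ge_half:
  fixes A :: "real mat"
  assumes A: "A \<in> carrier_mat m n" and b: "b \<in> carrier_vec m" and c: "c \<in> carrier_vec n"
    and B: "is_basis A B" and ne: "B \<noteq> {}" and sc: "strictly_complementary A b c (0\<^sub>v n) B x y s"
    and e: "eps A b c (0\<^sub>v n) = ereal e"
  obtains t where "0 < t"
    "\<And>a. 0 \<le> a \<Longrightarrow> a \<le> t \<Longrightarrow> \<exists>e'. eps A b c (vec n (\<lambda>_. a)) = ereal e' \<and> e / 2 \<le> e'"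
proof -
  have Bn: "B \<subseteq> {..<n}" using B A unfolding is_basis_def by auto
  obtain t where t: "0 < t"
    and near: "\<And>a. 0 \<le> a \<Longrightarrow> a \<le> t \<Longrightarrow> \<exists>x' y' s'. strictly_complementary A b c (vec n (\<lambda>_. a)) B x' y' s' \<and>
       (\<forall>i\<in>B. x $ i / 2 \<le> x' $ i + a) \<and> (\<forall>i\<in>{..<n} - B. s $ i / 2 \<le> s' $ i + a)"
    using strictly_complementary_perturbation[OF A b c B sc] by blast
  have "\<exists>e'. eps A b c (vec n (\<lambda>_. a)) = ereal e' \<and> e / 2 \<le> e'" if a: "0 \<le> a" "a \<le> t" for a
  proof -
    obtain x' y' s' where sc': "strictly_complementary A b c (vec n (\<lambda>_. a)) B x' y' s'"
      and x': "\<And>i. i \<in> B \<Longrightarrow> x $ i / 2 \<le> x' $ i + a"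
      and s': "\<And>i. i \<in> {..<n} - B \<Longrightarrow> s $ i / 2 \<le> s' $ i + a"
      using near[OF a] by blast
    have eps0: "ereal e \<le> (INF i\<in>B. ereal (x $ i + 0\<^sub>v n $ i))"
        "ereal e \<le> (INF i\<in>{..<n} - B. ereal (s $ i + 0\<^sub>v n $ i))"
      using eps_strictly_complementary[OF A b _ B sc] e by (auto simp: min_def split: if_splits)
    have eB: "e \<le> x $ i" if "i \<in> B" for i
    proof -
      have "i < n" using that Bn by auto
      then show ?thesis using order_trans[OF eps0(1) INF_lower[OF that]] by simp
    qed
    have eN: "e \<le> s $ i" if "i \<in> {..<n} - B" for i
      using order_trans[OF eps0(2) INF_lower[OF that]] that by simp
    have "ereal (e / 2) \<le> (INF i\<in>B. ereal (x' $ i + vec n (\<lambda>_. a) $ i))"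
    proof (rule INF_greatest)
      fix i assume i: "i \<in> B"
      then have "i < n" using Bn by auto
      then show "ereal (e / 2) \<le> ereal (x' $ i + vec n (\<lambda>_. a) $ i)"
        using eB[OF i] x'[OF i] by simp
    qed
    moreover have "ereal (e / 2) \<le> (INF i\<in>{..<n} - B. ereal (s' $ i + vec n (\<lambda>_. a) $ i))"
    proof (rule INF_greatest)
      fix i assume i: "i \<in> {..<n} - B"
      then show "ereal (e / 2) \<le> ereal (s' $ i + vec n (\<lambda>_. a) $ i)"
        using eN[OF i] s'[OF i] by simp
    qed
    ultimately have "ereal (e / 2) \<le> eps A b c (vec n (\<lambda>_. a))"
      using eps_strictly_complementary[OF A b _ B sc'] by simp
    moreover have "eps A b c (vec n (\<lambda>_. a)) < \<infinity>"
      using eps_strictly_complementary_pos_finite(2)[OF A b _ B ne sc'] by simp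
    ultimately show ?thesis by (cases "eps A b c (vec n (\<lambda>_. a))") auto
  qed
  then show thesis using that t by blast
qed

section \<open>Comparison of the thresholds\<close>

text \<open>
  The right-hand side increases with \<open>e'\<close>, so it is enough to treat \<open>e' = e/2\<close>. There the claim
  reduces, with \<open>\<gamma>\<close> replaced by 1, to \<open>4 e (2 \<surd>n + e) < n \<rho>\<close>. The two terms on the left are controlled by
  the two branches of the minimum: \<open>e \<surd>n\<close> by \<open>\<surd>\<rho>\<close>, and \<open>e\<^sup>2\<close> by 1.
\<close>

lemma perturbed_threshold_exceeds:
  fixes \<rho> e e' \<gamma> n :: real
  assumes "0 < n" "0 < \<rho>" "0 < e" "e / 2 \<le> e'" "0 < \<gamma>" "\<gamma> < 1"
    and small: "e \<le> 1 / 10 * sqrt (n * \<rho>) * min (sqrt \<rho>) 1"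
  shows "e\<^sup>2 / n\<^sup>2 * \<gamma> < \<rho> * e' / (4 * n * (sqrt n + e'))"
proof -
  define q r where "q = sqrt n" and "r = sqrt \<rho>"
  have q: "0 < q" "q\<^sup>2 = n" and r: "0 < r" "r\<^sup>2 = \<rho>" using assms unfolding q_def r_def by auto
  have small': "e \<le> 1 / 10 * (q * r) * min r 1"
    using small unfolding q_def r_def by (simp add: real_sqrt_mult)
  have "1 / 10 * (q * r) * min r 1 \<le> 1 / 10 * (q * r) * r"
    using q r by (intro mult_left_mono) auto
  then have e1: "e \<le> 1 / 10 * (q * r) * r" using small' by simp
  have "1 / 10 * (q * r) * min r 1 \<le> 1 / 10 * (q * r) * 1"
    using q r by (intro mult_left_mono) auto
  then have e2: "e \<le> 1 / 10 * (q * r)" using small' by simp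
  have "e * q \<le> 1 / 10 * (q * r) * r * q" using e1 q by (intro mult_right_mono) auto
  also have "\<dots> = 1 / 10 * (n * \<rho>)" unfolding q(2)[symmetric] r(2)[symmetric] by (simp add: power2_eq_square)
  finally have eq: "e * q \<le> 1 / 10 * (n * \<rho>)" .
  have "e * e \<le> (1 / 10 * (q * r)) * (1 / 10 * (q * r))" using e2 assms q r by (intro mult_mono) auto
  also have "\<dots> = 1 / 100 * (n * \<rho>)" unfolding q(2)[symmetric] r(2)[symmetric] by (simp add: power2_eq_square)
  finally have ee: "e * e \<le> 1 / 100 * (n * \<rho>)" .
  have np: "0 < n * \<rho>" using assms by simp
  \<comment> \<open>The left-hand side is at most \<open>(8/10 + 4/100) n \<rho>\<close>; this is where \<open>\<kappa> = 1/10\<close> suffices.\<close>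
  have key: "4 * e * (2 * q + e) < n * \<rho>" using eq ee np by (simp add: algebra_simps)
  have "0 < e\<^sup>2 / n\<^sup>2" using assms by simp
  then have "e\<^sup>2 / n\<^sup>2 * \<gamma> < e\<^sup>2 / n\<^sup>2" using assms(6) mult_strict_left_mono by fastforce
  also have "e\<^sup>2 / n\<^sup>2 < \<rho> * e / (4 * n * (2 * q + e))"
  proof -
    have D: "0 < 4 * n * (2 * q + e)" using assms q by simp
    have "e * n * (4 * e * (2 * q + e)) < e * n * (n * \<rho>)" using key assms by simp
    then have "e\<^sup>2 * (4 * n * (2 * q + e)) < \<rho> * e * n\<^sup>2"
      by (simp add: power2_eq_square algebra_simps)
    then have "e\<^sup>2 < \<rho> * e * n\<^sup>2 / (4 * n * (2 * q + e))"
      using D by (intro mult_imp_less_div_pos)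
    then show ?thesis using assms(1) by (intro mult_imp_div_pos_less) simp_all
  qed
  also have "\<dots> \<le> \<rho> * e' / (4 * n * (q + e'))"
  proof -
    have "e * (q + e') \<le> e' * (2 * q + e)"
      using mult_right_mono[OF assms(4), of q] q by (simp add: algebra_simps)
    then have "e / (2 * q + e) \<le> e' / (q + e')"
      using assms q by (simp add: frac_le_eq divide_le_0_iff)
    then have "\<rho> / (4 * n) * (e / (2 * q + e)) \<le> \<rho> / (4 * n) * (e' / (q + e'))"
      using assms by (intro mult_left_mono) auto
    then show ?thesis by simp
  qed
  finally show ?thesis unfolding q_def .
qed

theorem theorem8:
  shows "\<exists>\<kappa>::real. 0 < \<kappa> \<and>
    (\<forall>(m::nat) (n::nat) (A::real mat) (b::real vec) (c::real vec)
       (xs::real vec) (ys::real vec) (ss::real vec) (\<tau>p::real) (\<tau>d::real).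
      m \<le> n \<longrightarrow>
      A \<in> carrier_mat m n \<longrightarrow> b \<in> carrier_vec m \<longrightarrow> c \<in> carrier_vec n \<longrightarrow>
      vec_space.rank m A = m \<longrightarrow>
      pd_solutions A b c = {(xs, ys, ss)} \<longrightarrow>
      nondegenerate A b c xs ys ss \<longrightarrow>
      0 < psi_p A b c \<longrightarrow> psi_p A b c < \<infinity> \<longrightarrow>
      error_bound_constants A b c \<tau>p \<tau>d \<longrightarrow>
      (let \<psi> = real_of_ereal (psi_p A b c); \<rho> = \<psi> / max \<tau>p \<tau>d in
        eps A b c (0\<^sub>v n) \<le> ereal (\<kappa> * sqrt (real n * \<rho>) * min (sqrt \<rho>) 1) \<longrightarrow>
        (\<exists>lambar \<in> carrier_vec n. vec_lt (0\<^sub>v n) lambar \<and>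
          (\<forall>(\<gamma>::real) (\<alpha>::real) (lam::real vec).
            0 < \<gamma> \<longrightarrow> \<gamma> < 1 \<longrightarrow>
            0 < \<alpha> \<longrightarrow> \<alpha> < 1 \<longrightarrow> lam = \<alpha> \<cdot>\<^sub>v lambar \<longrightarrow>
            vec_lt (0\<^sub>v n) lam \<longrightarrow> vec_lt lam lambar \<longrightarrow>
            0 < enorm lam \<longrightarrow> enorm lam < min 1 (\<psi> / (16 * max \<tau>p \<tau>d)) \<longrightarrow>
            mu_max_pert A b c \<tau>p \<tau>d lam > mu_max A b c \<gamma>))))"
proof (intro exI[of _ "1 / 10"] conjI allI impI)
  fix m n :: nat and A :: "real mat" and b c x y s :: "real vec" and \<tau>p \<tau>d :: real
  assume A: "A \<in> carrier_mat m n" and b: "b \<in> carrier_vec m" and c: "c \<in> carrier_vec n"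
    and uniq: "pd_solutions A b c = {(x, y, s)}" and nd: "nondegenerate A b c x y s"
    and psi: "0 < psi_p A b c" "psi_p A b c < \<infinity>" and tau: "error_bound_constants A b c \<tau>p \<tau>d"
  obtain B where B: "is_basis A B" and sc: "strictly_complementary A b c (0\<^sub>v n) B x y s"
    using unique_nondegenerate_imp_strictly_complementary[OF A b c uniq nd] by blast
  have Bn: "B \<subseteq> {..<n}" using B A unfolding is_basis_def by auto
  \<comment> \<open>The minimum that defines \<open>psi_p\<close> would be infinite for the zero solution.\<close>
  have "B \<noteq> {}"
  proof
    assume "B = {}"
    then have none: "{i. i < n \<and> x $ i \<noteq> 0} = {}"
      using sc A unfolding strictly_complementary_def by auto
    have "psi_p A b c = (INF i\<in>{i. i < n \<and> x $ i \<noteq> 0}. ereal (x $ i))"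
      using strictly_complementary_unique_solutions(1)[OF A b _ B sc] A
      unfolding psi_p_def by simp
    then have "psi_p A b c = \<infinity>" unfolding none by (simp add: top_ereal_def)
    with psi show False by simp
  qed
  define \<psi> \<tau> where "\<psi> = real_of_ereal (psi_p A b c)" and "\<tau> = max \<tau>p \<tau>d"
  have \<psi>: "0 < \<psi>" unfolding \<psi>_def using psi by (cases "psi_p A b c") auto
  have \<tau>: "0 < \<tau>" unfolding \<tau>_def using tau unfolding error_bound_constants_def by auto
  have n: "0 < n" using \<open>B \<noteq> {}\<close> Bn by auto
  obtain e where e: "eps A b c (0\<^sub>v n) = ereal e" "0 < e"
    using eps_strictly_complementary_pos_finite[OF A b _ B \<open>B \<noteq> {}\<close> sc]
    by (cases "eps A b c (0\<^sub>v n)") auto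
  obtain t where t: "0 < t"
    and half: "\<And>a. 0 \<le> a \<Longrightarrow> a \<le> t \<Longrightarrow>
      \<exists>e'. eps A b c (vec n (\<lambda>_. a)) = ereal e' \<and> e / 2 \<le> e'"
    using eps_perturbation_ge_half[OF A b c B \<open>B \<noteq> {}\<close> sc e(1)] by blast
  define lambar where "lambar = vec n (\<lambda>_. t)"
  show "let \<psi> = real_of_ereal (psi_p A b c); \<rho> = \<psi> / max \<tau>p \<tau>d in
        eps A b c (0\<^sub>v n) \<le> ereal (1 / 10 * sqrt (real n * \<rho>) * min (sqrt \<rho>) 1) \<longrightarrow>
        (\<exists>lambar \<in> carrier_vec n. vec_lt (0\<^sub>v n) lambar \<and>
          (\<forall>(\<gamma>::real) (\<alpha>::real) (lam::real vec).
            0 < \<gamma> \<longrightarrow> \<gamma> < 1 \<longrightarrow>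
            0 < \<alpha> \<longrightarrow> \<alpha> < 1 \<longrightarrow> lam = \<alpha> \<cdot>\<^sub>v lambar \<longrightarrow>
            vec_lt (0\<^sub>v n) lam \<longrightarrow> vec_lt lam lambar \<longrightarrow>
            0 < enorm lam \<longrightarrow> enorm lam < min 1 (\<psi> / (16 * max \<tau>p \<tau>d)) \<longrightarrow>
            mu_max_pert A b c \<tau>p \<tau>d lam > mu_max A b c \<gamma>))"
    unfolding Let_def \<psi>_def[symmetric] \<tau>_def[symmetric]
  proof (intro impI bexI[of _ lambar] conjI allI)
    assume "eps A b c (0\<^sub>v n) \<le> ereal (1 / 10 * sqrt (real n * (\<psi> / \<tau>)) * min (sqrt (\<psi> / \<tau>)) 1)"
    then have small: "e \<le> 1 / 10 * sqrt (real n * (\<psi> / \<tau>)) * min (sqrt (\<psi> / \<tau>)) 1"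
      using e by simp
    show "lambar \<in> carrier_vec n" "vec_lt (0\<^sub>v n) lambar"
      using t unfolding lambar_def vec_lt_def by auto
    fix \<gamma> \<alpha> :: real and lam :: "real vec"
    assume \<gamma>: "0 < \<gamma>" "\<gamma> < 1" and \<alpha>: "0 < \<alpha>" "\<alpha> < 1" and lam: "lam = \<alpha> \<cdot>\<^sub>v lambar"
    have "lam = vec n (\<lambda>_. \<alpha> * t)" unfolding lam lambar_def by (intro eq_vecI) auto
    moreover have "0 \<le> \<alpha> * t" "\<alpha> * t \<le> t" using \<alpha> t by (simp_all add: mult_left_le_one_le)
    ultimately obtain e' where e': "eps A b c lam = ereal e'" "e / 2 \<le> e'" using half by metis
    have "mu_max A b c \<gamma> = e\<^sup>2 / (real n)\<^sup>2 * \<gamma>"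
      using A e unfolding mu_max_def Let_def by simp
    also have "\<dots> < (\<psi> / \<tau>) * e' / (4 * real n * (sqrt (real n) + e'))"
      using n \<psi> \<tau> e e' \<gamma> small by (intro perturbed_threshold_exceeds) auto
    also have "\<dots> = mu_max_pert A b c \<tau>p \<tau>d lam"
      using A e' unfolding mu_max_pert_def Let_def \<psi>_def \<tau>_def by (simp add: mult.commute mult.left_commute)
    finally show "mu_max A b c \<gamma> < mu_max_pert A b c \<tau>p \<tau>d lam" .
  qed
qed simp

end
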